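(* Let $A=(a_{ij})\in\mathbb{R}^{n\times n}$ be a symmetric matrix with $a_{ij}\le 0$ for all $i\neq j$ and $a_{ii}\ge 0$ for all $i$. Let $G$ be the support graph of $A$. If $G$ is bipartite, then \[ \operatorname{per}(A\circ A)\ \le\ \operatorname{per}(A)^2. \]
   Context: For an $n\times n$ matrix $A=(a_{ij})$, $\operatorname{per}(A)=\sum_{\sigma\in S_n}\prod_{i=1}^n a_{i,\sigma(i)}$. $A\circ B$ denotes the Hadamard (entrywise) product, $(A\circ B)_{ij}=a_{ij}b_{ij}$. The support graph of a symmetric matrix $A\in\mathbb{R}^{n\times n}$ is the simple graph on vertex set $\{1,\dots,n\}$ with an edge $\{i,j\}$ if and only if $i\neq j$ and $a_{ij}\neq 0$. *)

theory Defs
  imports "HOL-Analysis.Analysis" "Graph_Theory.Pair_Digraph"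
begin

definition per :: "'a::comm_semiring_1 ^ 'n ^ 'n \<Rightarrow> 'a" where
  "per A = (\<Sum>\<sigma> | \<sigma> permutes (UNIV :: 'n set). \<Prod>i\<in>UNIV. A $ i $ \<sigma> i)"

definition hadamard :: "'a::times ^ 'n ^ 'm \<Rightarrow> 'a ^ 'n ^ 'm \<Rightarrow> 'a ^ 'n ^ 'm" where
  "hadamard A B = (\<chi> i j. A $ i $ j * B $ i $ j)"

(* An undirected simple graph is a pair_graph: each edge {i, j} is represented
   by the two arcs (i, j) and (j, i). *)

definition support_graph :: "real ^ 'n ^ 'n \<Rightarrow> 'n pair_pre_digraph" where
  "support_graph A = \<lparr>pverts = UNIV, parcs = {(i, j). i \<noteq> j \<and> A $ i $ j \<noteq> 0}\<rparr>"

lemma pair_graph_support_graph: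
  fixes A :: "real ^ 'n ^ 'n"
  assumes "transpose A = A"
  shows "pair_graph (support_graph A)"
proof -
  have "A $ i $ j = A $ j $ i" for i j
    using assms by (metis transpose_def vec_lambda_beta)
  then show ?thesis
    by unfold_locales (auto simp: support_graph_def symmetric_def intro: symI)
qed

(* As usual, U or V may be empty. *)
definition bipartite :: "'a pair_pre_digraph \<Rightarrow> bool" where
  "bipartite G \<longleftrightarrow> (\<exists>U V. pverts G = U \<union> V \<and> U \<inter> V = {} \<and>
     (\<forall>(u, v)\<in>parcs G. (u \<in> U \<and> v \<in> V) \<or> (u \<in> V \<and> v \<in> U)))"

end

theory Submission
  imports Defs
begin

text \<open>A diagonal \<open>\<plusminus>1\<close> similarity that separates the two colour classes makes \<open>A\<close> entrywise
  nonnegative and changes no permutation product, because the signs of rows and columns cancel.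
  So \<open>per A\<close> is a sum of nonnegative terms, and its square dominates the sum of their squares.\<close>

lemma prod_permutes_nonneg:
  fixes f :: "'a \<Rightarrow> 'a \<Rightarrow> real" and d :: "'a \<Rightarrow> real"
  assumes \<sigma>: "\<sigma> permutes S"
    and d: "\<And>i. i \<in> S \<Longrightarrow> \<bar>d i\<bar> = 1"
    and nonneg: "\<And>i j. i \<in> S \<Longrightarrow> j \<in> S \<Longrightarrow> 0 \<le> d i * f i j * d j"
  shows "0 \<le> (\<Prod>i\<in>S. f i (\<sigma> i))"
proof -
  \<comment> \<open>Reindexing along \<open>\<sigma>\<close> gives the column signs the same product
    as the row signs, so the total sign is the square of \<open>prod d S\<close>.\<close>
  have "(\<Prod>i\<in>S. d (\<sigma> i)) = prod d S"
    using prod.permute[OF \<sigma>, of d] by (simp add: comp_def)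
  moreover have "prod d S * prod d S = 1"
  proof -
    have "d i * d i = 1" if "i \<in> S" for i
      using d[OF that] by (metis abs_mult_self_eq mult_1)
    then show ?thesis
      by (simp add: prod.distrib[symmetric])
  qed
  ultimately have "(\<Prod>i\<in>S. d i * f i (\<sigma> i) * d (\<sigma> i)) = (\<Prod>i\<in>S. f i (\<sigma> i))"
    by (simp add: prod.distrib mult.commute mult.left_commute)
  moreover have "0 \<le> (\<Prod>i\<in>S. d i * f i (\<sigma> i) * d (\<sigma> i))"
    by (intro prod_nonneg ballI nonneg) (simp_all add: permutes_in_image[OF \<sigma>])
  ultimately show ?thesis
    by simp
qed

text \<open>The Euclidean norm of a nonnegative family is at most its l1 norm; squaring removes the
  root. For infinite \<open>S\<close> both sums are 0 by convention.\<close>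

lemma sum_power2_le_power2_sum:
  fixes f :: "'a \<Rightarrow> real"
  assumes "\<And>i. i \<in> S \<Longrightarrow> 0 \<le> f i"
  shows "(\<Sum>i\<in>S. (f i)\<^sup>2) \<le> (sum f S)\<^sup>2"
  using L2_set_le_sum[of S f] assms unfolding L2_set_def by (blast intro: sqrt_le_D)

theorem theorem3p1:
  fixes A :: "real ^ 'n ^ 'n"
  assumes "transpose A = A"
    and "\<And>i j. i \<noteq> j \<Longrightarrow> A $ i $ j \<le> 0"
    and "\<And>i. A $ i $ i \<ge> 0"
    and "bipartite (support_graph A)"
  shows "per (hadamard A A) \<le> (per A)\<^sup>2"
proof -
  obtain U V where UV: "U \<inter> V = {}"
    and arcs: "\<And>i j. i \<noteq> j \<Longrightarrow> A $ i $ j \<noteq> 0 \<Longrightarrow> (i \<in> U \<and> j \<in> V) \<or> (i \<in> V \<and> j \<in> U)"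
    using assms(4) by (auto simp: bipartite_def support_graph_def)
  \<comment> \<open>\<open>V\<close> is disjoint from \<open>U\<close>, so it gets the sign -1, and
    the two ends of every arc get opposite signs.\<close>
  define d :: "'n \<Rightarrow> real" where "d = (\<lambda>i. if i \<in> U then 1 else - 1)"
  have "0 \<le> d i * A $ i $ j * d j" for i j
  proof (cases "i = j \<or> A $ i $ j = 0")
    case True
    then show ?thesis
      \<comment> \<open>On the diagonal the same sign occurs twice and cancels.\<close>
      using assms(3)[of i] by (auto simp: d_def)
  next
    case False
    then have "d i * d j = - 1"
      using arcs[of i j] UV by (auto simp: d_def)
    then have "d i * A $ i $ j * d j = - (A $ i $ j)"
      by (metis mult.assoc mult.commute mult_minus1)
    then show ?thesis
      using assms(2)[of i j] False by simp
  qed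
  then have "0 \<le> (\<Prod>i\<in>UNIV. A $ i $ \<sigma> i)" if "\<sigma> permutes UNIV" for \<sigma>
    using that prod_permutes_nonneg[of \<sigma> UNIV d "\<lambda>i j. A $ i $ j"] by (simp add: d_def)
  then have "(\<Sum>\<sigma> | \<sigma> permutes UNIV. (\<Prod>i\<in>UNIV. A $ i $ \<sigma> i)\<^sup>2) \<le> (per A)\<^sup>2"
    unfolding per_def by (intro sum_power2_le_power2_sum) simp
  then show ?thesis
    \<comment> \<open>Each term of \<open>per (hadamard A A)\<close> is the square of the term of
      \<open>per A\<close> for the same permutation.\<close>
    by (simp add: per_def hadamard_def power2_eq_square prod.distrib)
qed

end
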